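(* Let $n\geq 1$ be an integer and let $f\colon \mathbb{R}^n\to\mathbb{R}$ be a continuously differentiable convex function. If the gradient of $f$ has constant norm, i.e. there is a real constant $k\ge 0$ such that $|\nabla_u f|=k$ for all $u\in\mathbb{R}^n$, then $f$ is an affine mapping, i.e. there exist $c_1\in\mathbb{R}^n$ and $c_0\in\mathbb{R}$ such that $f(u)=\langle c_1,u\rangle+c_0$ for all $u\in\mathbb{R}^n$.
   Context: $\langle\cdot,\cdot\rangle$ and $|\cdot|$ denote the standard Euclidean inner product and norm on $\mathbb{R}^n$, and $\nabla_u f$ denotes the gradient of $f$ at the point $u$. *)

theory Defs
  imports "HOL-Analysis.Analysis"
begin

end

theory Submission
  imports Defs
begin

text \<open>
  If \<open>k > 0\<close>, minimise \<open>f\<close> over the closed ball of radius \<open>r\<close> about \<open>x\<close>. Convexity and the constant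
  gradient norm force the minimiser to be \<open>x - (r / k) grad x\<close>, with value at most \<open>f x - r k\<close>.
  Hence \<open>f\<close> decreases at full speed along the whole backward gradient line of \<open>x\<close>. Comparing this
  with the supporting hyperplane at \<open>y\<close> for \<open>r \<rightarrow> \<infinity>\<close> gives \<open>grad x \<bullet> grad y \<ge> k\<^sup>2\<close>, so \<open>grad\<close> is
  constant.
\<close>

lemma GDERIV_imp_directional_DERIV:
  assumes "GDERIV f x :> D"
  shows "((\<lambda>t. f (x + t *\<^sub>R d)) has_real_derivative d \<bullet> D) (at 0)"
proof -
  have "((\<lambda>t::real. x + t *\<^sub>R d) has_derivative (\<lambda>t. t *\<^sub>R d)) (at 0)"
    by (auto intro!: derivative_eq_intros)
  moreover have "(f has_derivative (\<lambda>h. h \<bullet> D)) (at (x + 0 *\<^sub>R d))"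
    using assms by (simp add: gderiv_def)
  ultimately have "((\<lambda>t. f (x + t *\<^sub>R d)) has_derivative (\<lambda>t. (t *\<^sub>R d) \<bullet> D)) (at 0)"
    by (rule has_derivative_compose)
  then show ?thesis
    by (simp add: has_field_derivative_def mult_commute_abs)
qed

text \<open>Restricting \<open>f\<close> to the line through \<open>x\<close> and \<open>y\<close>
  reduces this to the tangent inequality for convex functions of one real variable.\<close>

lemma convex_on_imp_above_gradient:
  assumes "convex_on UNIV f" "GDERIV f x :> D"
  shows "f y \<ge> f x + D \<bullet> (y - x)"
proof -
  define h where "h t = f (x + t *\<^sub>R (y - x))" for t
  have "convex_on UNIV h"
  proof (rule convex_onI)
    fix t a b :: real
    assume t: "0 < t" "t < 1"
    have "x + ((1 - t) *\<^sub>R a + t *\<^sub>R b) *\<^sub>R (y - x) =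
          (1 - t) *\<^sub>R (x + a *\<^sub>R (y - x)) + t *\<^sub>R (x + b *\<^sub>R (y - x))"
      by (simp add: algebra_simps)
    then show "h ((1 - t) *\<^sub>R a + t *\<^sub>R b) \<le> (1 - t) * h a + t * h b"
      unfolding h_def using convex_onD[OF assms(1), of t] t by simp
  qed simp
  moreover have "(h has_real_derivative (y - x) \<bullet> D) (at 0)"
    unfolding h_def by (rule GDERIV_imp_directional_DERIV[OF assms(2)])
  ultimately have "h 1 - h 0 \<ge> ((y - x) \<bullet> D) * (1 - 0)"
    by (intro convex_on_imp_above_tangent) auto
  then show ?thesis
    by (simp add: h_def inner_commute)
qed

text \<open>First-order optimality: a negative slope at \<open>m\<close> towards \<open>y\<close>
  would give values of \<open>f\<close> below \<open>f m\<close> on the segment from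
  \<open>m\<close> to \<open>y\<close>, which lies in \<open>S\<close>.\<close>

lemma gradient_at_min_on_convex:
  assumes "convex S" "m \<in> S" "y \<in> S" "GDERIV f m :> D" and min: "\<And>z. z \<in> S \<Longrightarrow> f m \<le> f z"
  shows "0 \<le> D \<bullet> (y - m)"
proof (rule ccontr)
  assume "\<not> ?thesis"
  then have "(y - m) \<bullet> D < 0"
    by (simp add: inner_commute)
  from DERIV_neg_dec_right[OF GDERIV_imp_directional_DERIV[OF assms(4)] this]
  obtain e where "e > 0"
    and e: "\<And>t. 0 < t \<Longrightarrow> t < e \<Longrightarrow> f (m + t *\<^sub>R (y - m)) < f m"
    by auto
  define t where "t = min (e / 2) 1"
  have t: "0 < t" "t < e" "t \<le> 1"
    using \<open>e > 0\<close> by (auto simp: t_def min_def)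
  have "(1 - t) *\<^sub>R m + t *\<^sub>R y \<in> S"
    using assms(1-3) t by (intro convexD) auto
  then have "m + t *\<^sub>R (y - m) \<in> S"
    by (simp add: algebra_simps)
  with min e t show False
    by (meson not_less)
qed

lemma convex_backward_gradient_descent:
  fixes f :: "'a::euclidean_space \<Rightarrow> real"
  assumes grad: "\<And>u. GDERIV f u :> grad u" and conv: "convex_on UNIV f"
    and norm: "\<And>u. norm (grad u) = k" and "k > 0" "r \<ge> 0"
  shows "f (x - (r / k) *\<^sub>R grad x) \<le> f x - r * k"
proof -
  have cont: "continuous_on (cball x r) f"
    using grad by (auto simp: gderiv_def intro!: continuous_at_imp_continuous_on has_derivative_continuous)
  obtain m where m: "m \<in> cball x r" and min: "\<And>z. z \<in> cball x r \<Longrightarrow> f m \<le> f z"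
    using continuous_attains_inf[OF compact_cball _ cont] \<open>r \<ge> 0\<close> by auto
  have self: "grad u \<bullet> grad u = k\<^sup>2" for u
    using norm by (simp add: dot_square_norm)
  \<comment> \<open>The linear form given by \<open>grad m\<close> attains its least value over the
    ball at this point, so testing the optimality of \<open>m\<close> here gives the strongest
    bound.\<close>
  have "x - (r / k) *\<^sub>R grad m \<in> cball x r"
    using norm[of m] \<open>k > 0\<close> \<open>r \<ge> 0\<close> by (simp add: dist_norm)
  from gradient_at_min_on_convex[OF convex_cball m this grad min]
  have "0 \<le> grad m \<bullet> (x - m) - (r / k) * k\<^sup>2"
    by (simp add: inner_diff_right self)
  then have "r * k \<le> grad m \<bullet> (x - m)"
    using \<open>k > 0\<close> by (simp add: power2_eq_square)
  with convex_on_imp_above_gradient[OF conv grad, of m x] have fm: "f m \<le> f x - r * k"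
    by simp
  \<comment> \<open>The supporting hyperplane at \<open>x\<close> turns the drop in value at
    \<open>m\<close> into a statement about \<open>grad x\<close> instead of
    \<open>grad m\<close>.\<close>
  with convex_on_imp_above_gradient[OF conv grad, of x m]
  have 1: "r * k \<le> grad x \<bullet> (x - m)"
    by (simp add: inner_diff_right)
  have 2: "(norm (x - m))\<^sup>2 \<le> r\<^sup>2"
    using m by (intro power_mono) (auto simp: dist_norm)
  \<comment> \<open>Equality case of Cauchy-Schwarz: \<open>x - m\<close> has norm at most
    \<open>r\<close>, \<open>grad x\<close> has norm \<open>k\<close>, and their inner product is at
    least \<open>r * k\<close>.\<close>
  have "(norm ((x - m) - (r / k) *\<^sub>R grad x))\<^sup>2
      = (norm (x - m))\<^sup>2 - 2 * (r / k) * (grad x \<bullet> (x - m)) + r\<^sup>2"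
    unfolding power2_norm_eq_inner inner_diff_left[of "x - m"] inner_diff_right[of _ "x - m"]
    using \<open>k > 0\<close> by (simp add: self power_divide inner_commute power2_eq_square)
  also have "\<dots> \<le> r\<^sup>2 - 2 * (r / k) * (r * k) + r\<^sup>2"
    using \<open>k > 0\<close> \<open>r \<ge> 0\<close> by (intro add_mono diff_mono mult_left_mono 1 2) auto
  also have "\<dots> = 0"
    using \<open>k > 0\<close> by (simp add: power2_eq_square)
  finally have "m = x - (r / k) *\<^sub>R grad x"
    by (simp add: algebra_simps)
  with fm show ?thesis by simp
qed

lemma convex_constant_gradient_norm:
  fixes f :: "'a::euclidean_space \<Rightarrow> real"
  assumes grad: "\<And>u. GDERIV f u :> grad u" and conv: "convex_on UNIV f"
    and norm: "\<And>u. norm (grad u) = k"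
  shows "grad x = grad y"
proof (cases "k > 0")
  case False
  then have "k = 0"
    using norm[of x] norm_ge_zero[of "grad x"] by linarith
  then show ?thesis
    using norm[of x] norm[of y] by simp
next
  case True
  have self: "grad u \<bullet> grad u = k\<^sup>2" for u
    using norm by (simp add: dot_square_norm)
  \<comment> \<open>\<open>C\<close> collects the terms free of \<open>s\<close>; a linear function
    of \<open>s\<close> bounded by it on the half-line cannot have positive slope.\<close>
  define C where "C = f x - f y - grad y \<bullet> (x - y)"
  have bound: "s * (k\<^sup>2 - grad y \<bullet> grad x) \<le> C" if "s \<ge> 0" for s
  proof -
    \<comment> \<open>The radius \<open>s * k\<close> makes the factor \<open>r / k\<close> equal to
      \<open>s\<close>.\<close>
    have "f (x - s *\<^sub>R grad x) \<le> f x - s * k\<^sup>2"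
      using convex_backward_gradient_descent[OF grad conv norm True, of "s * k" x] True that
      by (simp add: power2_eq_square mult.assoc)
    with convex_on_imp_above_gradient[OF conv grad, of y "x - s *\<^sub>R grad x"] show ?thesis
      by (simp add: C_def algebra_simps inner_diff_right)
  qed
  have "k\<^sup>2 - grad y \<bullet> grad x \<le> 0"
  proof (rule ccontr)
    assume "\<not> ?thesis"
    then have pos: "k\<^sup>2 - grad y \<bullet> grad x > 0" by simp
    then obtain n :: nat where "C < real n * (k\<^sup>2 - grad y \<bullet> grad x)"
      using ex_less_of_nat_mult by blast
    with bound[of "real n"] show False by simp
  qed
  moreover have "(norm (grad x - grad y))\<^sup>2 = 2 * (k\<^sup>2 - grad y \<bullet> grad x)"
    by (simp add: power2_norm_eq_inner inner_diff_left inner_diff_right self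
        inner_commute[of "grad x" "grad y"])
  ultimately have "(norm (grad x - grad y))\<^sup>2 \<le> 0" by simp
  then show ?thesis by simp
qed

theorem theorem1:
  fixes f :: "real ^ 'n \<Rightarrow> real"
    and grad :: "real ^ 'n \<Rightarrow> real ^ 'n"
    and k :: real
  assumes "\<And>u. GDERIV f u :> grad u"
    and "continuous_on UNIV grad"
    and "convex_on UNIV f"
    and "k \<ge> 0"
    and "\<And>u. norm (grad u) = k"
  shows "\<exists>(c\<^sub>1 :: real ^ 'n) (c\<^sub>0 :: real). \<forall>u. f u = c\<^sub>1 \<bullet> u + c\<^sub>0"
proof (intro exI allI)
  fix u
  have "grad u = grad 0"
    by (rule convex_constant_gradient_norm[OF assms(1,3,5)])
  \<comment> \<open>The supporting hyperplanes at 0 and at \<open>u\<close> have the same gradient,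
    so they give opposite inequalities.\<close>
  then show "f u = grad 0 \<bullet> u + f 0"
    using convex_on_imp_above_gradient[OF assms(3,1), of 0 u]
      convex_on_imp_above_gradient[OF assms(3,1), of u 0]
    by simp
qed

end
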